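(* Let $X$ be a set, let $\langle(Y_\alpha,\mu_\alpha)\mid\alpha\in J\rangle$ be an indexed family of generalized topological spaces, and let $\langle f_\alpha:X\to Y_\alpha\mid\alpha\in J\rangle$ be a source of functions in $\mathbf{Set}$. (1) If each $(Y_\alpha,\mu_\alpha)$ is regular (respectively, completely regular), then the initial (weak) GTS structure on $X$ defined by this source is regular (respectively, completely regular). (2) If each $(Y_\alpha,\mu_\alpha)$ is $T_0$ (respectively $T_1$, $T_2$, $T_3$, $T_{3.5}$) and moreover $\langle f_\alpha\mid\alpha\in J\rangle$ is point-separating, then the initial (weak) GTS structure on $X$ defined by this source is $T_0$ (respectively $T_1$, $T_2$, $T_3$, $T_{3.5}$). In particular, subspaces and products of GTS's that are $T_0$ (respectively $T_1$, $T_2$, regular, $T_3$, completely regular, $T_{3.5}$) are $T_0$ (respectively $T_1$, $T_2$, regular, $T_3$, completely regular, $T_{3.5}$).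
   Context: A generalized topology (GT) on a set $X$ (possibly empty) is a family $\mu\subset P(X)$ with $\emptyset\in\mu$ closed under arbitrary unions; $(X,\mu)$ is a generalized topological space (GTS); members of $\mu$ are open, their complements closed. A map $f:(X,\mu)\to(Y,\nu)$ is continuous if $f^{-1}(N)\in\mu$ for all $N\in\nu$. The initial (weak) structure on $X$ with respect to functions $f_\alpha:X\to Y_\alpha$ into GTS's $(Y_\alpha,\mu_\alpha)$ ($\alpha\in J$) is the GT $\{\bigcup_{\alpha\in J}f_\alpha^{-1}(M_\alpha)\mid M_\alpha\in\mu_\alpha\}$. The source $\langle f_\alpha\rangle$ is point-separating if for distinct $x_1,x_2\in X$ there is $\alpha\in J$ with $f_\alpha(x_1)\ne f_\alpha(x_2)$. The subspace on $X_0\subset X$ has GT $\{M\cap X_0\mid M\in\mu\}$. Products are categorical: $\prod_{\alpha\in J}(Y_\alpha,\mu_\alpha)$ is the set $\prod_\alpha Y_\alpha$ with the initial structure for the projections (the empty product is a one-point set with GT $\{\emptyset\}$). Separation axioms are defined word for word as for topological spaces. $T_0$: for distinct points some open set contains exactly one of them. $T_1$: for distinct $x,y$ some open set contains $x$ but not $y$. $T_2$: distinct points have disjoint open sets containing them. Regular: for each closed $F$ and $x\notin F$ there are disjoint open sets $M\ni x$ and $M'\supset F$. $T_3$: regular and $T_1$. Completely regular: for each closed $F$ and $x\notin F$ there is a continuous $f:(X,\mu)\to([0,1],\gamma_0)$ with $f(x)=0$ and $f(F)\subset\{1\}$, where $\gamma_0$ is the GT on $[0,1]$ consisting of all unions of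 (possibly empty) subfamilies of $\{[0,1]\cap(-\infty,s)\mid s\in\mathbb{R}\}\cup\{[0,1]\cap(t,\infty)\mid t\in\mathbb{R}\}$. $T_{3.5}$: completely regular and $T_1$. *)

theory Defs
  imports Complex_Main "HOL-Library.FuncSet"
begin

text \<open>The underlying set is always given explicitly: unlike for a topology, it need not be open,
  so it cannot be recovered as the union of the open sets.\<close>

definition gts :: "'a set \<Rightarrow> 'a set set \<Rightarrow> bool" where
  "gts X \<mu> \<longleftrightarrow> \<mu> \<subseteq> Pow X \<and> {} \<in> \<mu> \<and> (\<forall>\<U>. \<U> \<subseteq> \<mu> \<longrightarrow> \<Union>\<U> \<in> \<mu>)"

definition gt_closed :: "'a set \<Rightarrow> 'a set set \<Rightarrow> 'a set \<Rightarrow> bool" where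
  "gt_closed X \<mu> F \<longleftrightarrow> F \<subseteq> X \<and> X - F \<in> \<mu>"

definition gt_continuous ::
    "'a set \<Rightarrow> 'a set set \<Rightarrow> 'b set \<Rightarrow> 'b set set \<Rightarrow> ('a \<Rightarrow> 'b) \<Rightarrow> bool" where
  "gt_continuous X \<mu> Y \<nu> f \<longleftrightarrow> f \<in> X \<rightarrow> Y \<and> (\<forall>N\<in>\<nu>. f -` N \<inter> X \<in> \<mu>)"

definition initial_gt ::
    "'a set \<Rightarrow> 'j set \<Rightarrow> ('j \<Rightarrow> 'b set set) \<Rightarrow> ('j \<Rightarrow> 'a \<Rightarrow> 'b) \<Rightarrow> 'a set set" where
  "initial_gt X J \<mu> f = {\<Union>\<alpha>\<in>J. f \<alpha> -` M \<alpha> \<inter> X | M. \<forall>\<alpha>\<in>J. M \<alpha> \<in> \<mu> \<alpha>}"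

definition point_separating :: "'a set \<Rightarrow> 'j set \<Rightarrow> ('j \<Rightarrow> 'a \<Rightarrow> 'b) \<Rightarrow> bool" where
  "point_separating X J f \<longleftrightarrow>
     (\<forall>x\<^sub>1\<in>X. \<forall>x\<^sub>2\<in>X. x\<^sub>1 \<noteq> x\<^sub>2 \<longrightarrow> (\<exists>\<alpha>\<in>J. f \<alpha> x\<^sub>1 \<noteq> f \<alpha> x\<^sub>2))"

definition subspace_gt :: "'a set set \<Rightarrow> 'a set \<Rightarrow> 'a set set" where
  "subspace_gt \<mu> X\<^sub>0 = {M \<inter> X\<^sub>0 | M. M \<in> \<mu>}"

definition product_gt :: "'j set \<Rightarrow> ('j \<Rightarrow> 'b set) \<Rightarrow> ('j \<Rightarrow> 'b set set) \<Rightarrow> ('j \<Rightarrow> 'b) set set" where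
  "product_gt J Y \<mu> = initial_gt (Pi\<^sub>E J Y) J \<mu> (\<lambda>\<alpha> y. y \<alpha>)"

definition gamma0 :: "real set set" where
  "gamma0 = {\<Union>\<S> | \<S>. \<S> \<subseteq> {{0..1} \<inter> {..<s} | s. True} \<union> {{0..1} \<inter> {t<..} | t. True}}"

definition gt_T0 :: "'a set \<Rightarrow> 'a set set \<Rightarrow> bool" where
  "gt_T0 X \<mu> \<longleftrightarrow> (\<forall>x\<in>X. \<forall>y\<in>X. x \<noteq> y \<longrightarrow> (\<exists>M\<in>\<mu>. (x \<in> M) \<noteq> (y \<in> M)))"

definition gt_T1 :: "'a set \<Rightarrow> 'a set set \<Rightarrow> bool" where
  "gt_T1 X \<mu> \<longleftrightarrow> (\<forall>x\<in>X. \<forall>y\<in>X. x \<noteq> y \<longrightarrow> (\<exists>M\<in>\<mu>. x \<in> M \<and> y \<notin> M))"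

definition gt_T2 :: "'a set \<Rightarrow> 'a set set \<Rightarrow> bool" where
  "gt_T2 X \<mu> \<longleftrightarrow>
     (\<forall>x\<in>X. \<forall>y\<in>X. x \<noteq> y \<longrightarrow> (\<exists>M\<in>\<mu>. \<exists>N\<in>\<mu>. x \<in> M \<and> y \<in> N \<and> M \<inter> N = {}))"

definition gt_regular :: "'a set \<Rightarrow> 'a set set \<Rightarrow> bool" where
  "gt_regular X \<mu> \<longleftrightarrow>
     (\<forall>F. gt_closed X \<mu> F \<longrightarrow>
       (\<forall>x \<in> X - F. \<exists>M\<in>\<mu>. \<exists>M'\<in>\<mu>. x \<in> M \<and> F \<subseteq> M' \<and> M \<inter> M' = {}))"

definition gt_T3 :: "'a set \<Rightarrow> 'a set set \<Rightarrow> bool" where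
  "gt_T3 X \<mu> \<longleftrightarrow> gt_regular X \<mu> \<and> gt_T1 X \<mu>"

definition gt_completely_regular :: "'a set \<Rightarrow> 'a set set \<Rightarrow> bool" where
  "gt_completely_regular X \<mu> \<longleftrightarrow>
     (\<forall>F. gt_closed X \<mu> F \<longrightarrow>
       (\<forall>x \<in> X - F. \<exists>f. gt_continuous X \<mu> {0..1} gamma0 f \<and> f x = 0 \<and> f ` F \<subseteq> {1}))"

definition gt_T3_5 :: "'a set \<Rightarrow> 'a set set \<Rightarrow> bool" where
  "gt_T3_5 X \<mu> \<longleftrightarrow> gt_completely_regular X \<mu> \<and> gt_T1 X \<mu>"

lemma gts_initial_gt:
  assumes "\<And>\<alpha>. \<alpha> \<in> J \<Longrightarrow> gts (Y \<alpha>) (\<mu> \<alpha>)"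
  shows "gts X (initial_gt X J \<mu> f)"
  unfolding gts_def
proof (intro conjI allI impI)
  show "initial_gt X J \<mu> f \<subseteq> Pow X"
    unfolding initial_gt_def by blast
  have "\<forall>\<alpha>\<in>J. {} \<in> \<mu> \<alpha>"
    using assms unfolding gts_def by blast
  then show "{} \<in> initial_gt X J \<mu> f"
    unfolding initial_gt_def by (auto intro!: exI[of _ "\<lambda>_. {}"])
next
  fix \<U> assume "\<U> \<subseteq> initial_gt X J \<mu> f"
  then have "\<forall>U\<in>\<U>. \<exists>M. U = (\<Union>\<alpha>\<in>J. f \<alpha> -` M \<alpha> \<inter> X) \<and> (\<forall>\<alpha>\<in>J. M \<alpha> \<in> \<mu> \<alpha>)"
    unfolding initial_gt_def by blast
  then obtain M where M: "\<And>U. U \<in> \<U> \<Longrightarrow> U = (\<Union>\<alpha>\<in>J. f \<alpha> -` M U \<alpha> \<inter> X)"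
      "\<And>U \<alpha>. U \<in> \<U> \<Longrightarrow> \<alpha> \<in> J \<Longrightarrow> M U \<alpha> \<in> \<mu> \<alpha>"
    by metis
  define N where "N = (\<lambda>\<alpha>. \<Union>U\<in>\<U>. M U \<alpha>)"
  have "\<Union>\<U> = (\<Union>U\<in>\<U>. \<Union>\<alpha>\<in>J. f \<alpha> -` M U \<alpha> \<inter> X)"
    using M(1) by simp
  also have "\<dots> = (\<Union>\<alpha>\<in>J. f \<alpha> -` N \<alpha> \<inter> X)"
    unfolding N_def by blast
  finally have "\<Union>\<U> = (\<Union>\<alpha>\<in>J. f \<alpha> -` N \<alpha> \<inter> X)" .
  moreover have "N \<alpha> \<in> \<mu> \<alpha>" if "\<alpha> \<in> J" for \<alpha>
  proof -
    have "(\<lambda>U. M U \<alpha>) ` \<U> \<subseteq> \<mu> \<alpha>"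
      using M(2) that by blast
    then show ?thesis
      using assms[OF that] unfolding gts_def N_def by blast
  qed
  ultimately show "\<Union>\<U> \<in> initial_gt X J \<mu> f"
    unfolding initial_gt_def by blast
qed

end

theory Submission
  imports Defs
begin

text \<open>Two facts about the initial structure carry the proof: it makes every map of the source
  continuous (lemma \<open>gt_continuous_initial_gt\<close>), and the preimages \<open>f \<alpha> -` M\<close> of open sets under
  \<^emph>\<open>single\<close> maps form a base of it (lemma \<open>initial_gt_base\<close>). In the topological case only finite
  intersections of such preimages form a base; here there are no intersections to deal with, so
  each separation problem in \<open>X\<close> reduces to one factor.

  For the axioms about two points \<open>x \<noteq> y\<close>, point separation gives an \<open>\<alpha>\<close> with
  \<open>f \<alpha> x \<noteq> f \<alpha> y\<close>, and the open sets that separate these images pull back to \<open>X\<close> by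
  continuity. For the axioms about a closed set \<open>F\<close> and a point \<open>x \<notin> F\<close>, the base gives an \<open>\<alpha>\<close> and
  a closed \<open>G \<subseteq> Y \<alpha>\<close> with \<open>f \<alpha> x \<notin> G\<close> and \<open>f \<alpha> ` F \<subseteq> G\<close>
  (lemma \<open>initial_gt_separates_closed\<close>). What separates \<open>f \<alpha> x\<close> from \<open>G\<close>, be it a pair of open
  sets or a function into the unit interval, pulls back along \<open>f \<alpha>\<close> and separates \<open>x\<close> from \<open>F\<close>.

  A subspace carries the initial structure of its inclusion, and a product that of its projections;
  both sources are point-separating.\<close>

lemma gt_continuousD:
  assumes "gt_continuous X \<mu> Y \<nu> f"
  shows "x \<in> X \<Longrightarrow> f x \<in> Y" and "N \<in> \<nu> \<Longrightarrow> f -` N \<inter> X \<in> \<mu>"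
  using assms unfolding gt_continuous_def by auto

lemma gt_continuous_compose:
  assumes f: "gt_continuous X \<mu> Y \<nu> f" and g: "gt_continuous Y \<nu> Z \<rho> g"
  shows "gt_continuous X \<mu> Z \<rho> (\<lambda>x. g (f x))"
  unfolding gt_continuous_def
proof (intro conjI ballI)
  show "(\<lambda>x. g (f x)) \<in> X \<rightarrow> Z"
    using gt_continuousD(1)[OF f] gt_continuousD(1)[OF g] by blast
  fix N assume "N \<in> \<rho>"
  then have "f -` (g -` N \<inter> Y) \<inter> X \<in> \<mu>"
    by (intro gt_continuousD(2)[OF f] gt_continuousD(2)[OF g])
  moreover have "f -` (g -` N \<inter> Y) \<inter> X = (\<lambda>x. g (f x)) -` N \<inter> X"
    using gt_continuousD(1)[OF f] by auto
  ultimately show "(\<lambda>x. g (f x)) -` N \<inter> X \<in> \<mu>" by simp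
qed

section \<open>The initial structure\<close>

text \<open>A member of the initial structure takes one open set from every factor. A single preimage is
  of this form because the empty set is open in the other factors.\<close>

lemma gt_continuous_initial_gt:
  assumes empty: "\<And>\<beta>. \<beta> \<in> J \<Longrightarrow> {} \<in> \<mu> \<beta>" and \<alpha>: "\<alpha> \<in> J" and f: "f \<alpha> \<in> X \<rightarrow> Y"
  shows "gt_continuous X (initial_gt X J \<mu> f) Y (\<mu> \<alpha>) (f \<alpha>)"
  unfolding gt_continuous_def
proof (intro conjI ballI f)
  fix N assume N: "N \<in> \<mu> \<alpha>"
  define M where "M = (\<lambda>\<beta>. if \<beta> = \<alpha> then N else {})"
  have "\<forall>\<beta>\<in>J. M \<beta> \<in> \<mu> \<beta>"
    using N empty by (simp add: M_def)
  moreover have "f \<alpha> -` N \<inter> X = (\<Union>\<beta>\<in>J. f \<beta> -` M \<beta> \<inter> X)"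
    using \<alpha> by (auto simp: M_def split: if_splits)
  ultimately show "f \<alpha> -` N \<inter> X \<in> initial_gt X J \<mu> f"
    unfolding initial_gt_def by blast
qed

lemma initial_gt_base:
  assumes "U \<in> initial_gt X J \<mu> f" and "x \<in> U"
  obtains \<alpha> M where "\<alpha> \<in> J" "M \<in> \<mu> \<alpha>" "x \<in> f \<alpha> -` M \<inter> X" "f \<alpha> -` M \<inter> X \<subseteq> U"
  using assms unfolding initial_gt_def by blast

text \<open>Around \<open>x\<close>, the complement of \<open>F\<close> contains a basic open set \<open>f \<alpha> -` M\<close>. As this set
  misses \<open>F\<close>, the map \<open>f \<alpha>\<close> sends \<open>F\<close> into the complement of \<open>M\<close>, which serves as \<open>G\<close>.\<close>

lemma initial_gt_separates_closed:
  assumes gts: "\<And>\<alpha>. \<alpha> \<in> J \<Longrightarrow> gts (Y \<alpha>) (\<mu> \<alpha>)" and f: "\<And>\<alpha>. \<alpha> \<in> J \<Longrightarrow> f \<alpha> \<in> X \<rightarrow> Y \<alpha>"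
    and F: "gt_closed X (initial_gt X J \<mu> f) F" and x: "x \<in> X - F"
  obtains \<alpha> G where "\<alpha> \<in> J" "gt_closed (Y \<alpha>) (\<mu> \<alpha>) G" "f \<alpha> x \<in> Y \<alpha> - G" "f \<alpha> ` F \<subseteq> G"
proof -
  from F have FX: "F \<subseteq> X" and "X - F \<in> initial_gt X J \<mu> f"
    unfolding gt_closed_def by auto
  then obtain \<alpha> M where \<alpha>: "\<alpha> \<in> J" and M: "M \<in> \<mu> \<alpha>"
    and xM: "x \<in> f \<alpha> -` M \<inter> X" and sub: "f \<alpha> -` M \<inter> X \<subseteq> X - F"
    using x by (elim initial_gt_base)
  have MY: "M \<subseteq> Y \<alpha>"
    using gts[OF \<alpha>] M unfolding gts_def by blast
  show thesis
  proof
    show "\<alpha> \<in> J" by (fact \<alpha>)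
    show "gt_closed (Y \<alpha>) (\<mu> \<alpha>) (Y \<alpha> - M)"
      using M MY by (simp add: gt_closed_def double_diff)
    show "f \<alpha> x \<in> Y \<alpha> - (Y \<alpha> - M)"
      using xM MY by auto
    show "f \<alpha> ` F \<subseteq> Y \<alpha> - M"
      using f[OF \<alpha>] FX sub by auto
  qed
qed

section \<open>Separating a point from a closed set\<close>

lemma gt_regular_initial_gt:
  assumes gts: "\<And>\<alpha>. \<alpha> \<in> J \<Longrightarrow> gts (Y \<alpha>) (\<mu> \<alpha>)" and f: "\<And>\<alpha>. \<alpha> \<in> J \<Longrightarrow> f \<alpha> \<in> X \<rightarrow> Y \<alpha>"
    and regular: "\<And>\<alpha>. \<alpha> \<in> J \<Longrightarrow> gt_regular (Y \<alpha>) (\<mu> \<alpha>)"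
  shows "gt_regular X (initial_gt X J \<mu> f)"
  unfolding gt_regular_def
proof (intro allI impI ballI)
  fix F x assume F: "gt_closed X (initial_gt X J \<mu> f) F" and x: "x \<in> X - F"
  obtain \<alpha> G where \<alpha>: "\<alpha> \<in> J" and G: "gt_closed (Y \<alpha>) (\<mu> \<alpha>) G"
    and fx: "f \<alpha> x \<in> Y \<alpha> - G" and fF: "f \<alpha> ` F \<subseteq> G"
    using initial_gt_separates_closed[OF gts f F x] by blast
  obtain N N' where N: "N \<in> \<mu> \<alpha>" "N' \<in> \<mu> \<alpha>" "f \<alpha> x \<in> N" "G \<subseteq> N'" "N \<inter> N' = {}"
    using regular[OF \<alpha>] G fx unfolding gt_regular_def by blast
  have cont: "gt_continuous X (initial_gt X J \<mu> f) (Y \<alpha>) (\<mu> \<alpha>) (f \<alpha>)"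
    using gts f[OF \<alpha>] \<alpha> by (intro gt_continuous_initial_gt) (auto simp: gts_def)
  have "f \<alpha> -` N \<inter> X \<in> initial_gt X J \<mu> f" "f \<alpha> -` N' \<inter> X \<in> initial_gt X J \<mu> f"
    using N(1,2) by (blast intro: gt_continuousD(2)[OF cont])+
  moreover have "x \<in> f \<alpha> -` N \<inter> X" "(f \<alpha> -` N \<inter> X) \<inter> (f \<alpha> -` N' \<inter> X) = {}"
    using x N(3,5) by auto
  moreover have "F \<subseteq> f \<alpha> -` N' \<inter> X"
    using fF N(4) F unfolding gt_closed_def by auto
  ultimately show "\<exists>M\<in>initial_gt X J \<mu> f. \<exists>M'\<in>initial_gt X J \<mu> f.
      x \<in> M \<and> F \<subseteq> M' \<and> M \<inter> M' = {}"
    by (meson bexI)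
qed

lemma gt_completely_regular_initial_gt:
  assumes gts: "\<And>\<alpha>. \<alpha> \<in> J \<Longrightarrow> gts (Y \<alpha>) (\<mu> \<alpha>)" and f: "\<And>\<alpha>. \<alpha> \<in> J \<Longrightarrow> f \<alpha> \<in> X \<rightarrow> Y \<alpha>"
    and regular: "\<And>\<alpha>. \<alpha> \<in> J \<Longrightarrow> gt_completely_regular (Y \<alpha>) (\<mu> \<alpha>)"
  shows "gt_completely_regular X (initial_gt X J \<mu> f)"
  unfolding gt_completely_regular_def
proof (intro allI impI ballI)
  fix F x assume F: "gt_closed X (initial_gt X J \<mu> f) F" and x: "x \<in> X - F"
  obtain \<alpha> G where \<alpha>: "\<alpha> \<in> J" and G: "gt_closed (Y \<alpha>) (\<mu> \<alpha>) G"
    and fx: "f \<alpha> x \<in> Y \<alpha> - G" and fF: "f \<alpha> ` F \<subseteq> G"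
    using initial_gt_separates_closed[OF gts f F x] by blast
  obtain g where g: "gt_continuous (Y \<alpha>) (\<mu> \<alpha>) {0..1} gamma0 g" "g (f \<alpha> x) = 0" "g ` G \<subseteq> {1}"
    using regular[OF \<alpha>] G fx unfolding gt_completely_regular_def by blast
  have "gt_continuous X (initial_gt X J \<mu> f) (Y \<alpha>) (\<mu> \<alpha>) (f \<alpha>)"
    using gts f[OF \<alpha>] \<alpha> by (intro gt_continuous_initial_gt) (auto simp: gts_def)
  then have "gt_continuous X (initial_gt X J \<mu> f) {0..1} gamma0 (\<lambda>x. g (f \<alpha> x))"
    using g(1) by (rule gt_continuous_compose)
  moreover have "(\<lambda>x. g (f \<alpha> x)) ` F \<subseteq> {1}"
    using g(3) fF by auto
  ultimately show "\<exists>h. gt_continuous X (initial_gt X J \<mu> f) {0..1} gamma0 h \<and>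
      h x = 0 \<and> h ` F \<subseteq> {1}"
    using g(2) by blast
qed

section \<open>Separating two points\<close>

text \<open>The next three lemmas hold for every structure on \<open>X\<close> that makes the maps of the source
  continuous, of which the initial structure is the coarsest: finer structures keep these axioms,
  whereas they need not keep regularity.\<close>

lemma gt_T0_point_separating:
  assumes sep: "point_separating X J f"
    and cont: "\<And>\<alpha>. \<alpha> \<in> J \<Longrightarrow> gt_continuous X \<tau> (Y \<alpha>) (\<mu> \<alpha>) (f \<alpha>)"
    and T0: "\<And>\<alpha>. \<alpha> \<in> J \<Longrightarrow> gt_T0 (Y \<alpha>) (\<mu> \<alpha>)"
  shows "gt_T0 X \<tau>"
  unfolding gt_T0_def
proof (intro ballI impI)
  fix x y assume xy: "x \<in> X" "y \<in> X" "x \<noteq> y"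
  then obtain \<alpha> where \<alpha>: "\<alpha> \<in> J" "f \<alpha> x \<noteq> f \<alpha> y"
    using sep unfolding point_separating_def by blast
  then obtain M where M: "M \<in> \<mu> \<alpha>" "(f \<alpha> x \<in> M) \<noteq> (f \<alpha> y \<in> M)"
    using T0[OF \<alpha>(1)] gt_continuousD(1)[OF cont[OF \<alpha>(1)]] xy unfolding gt_T0_def by blast
  show "\<exists>M\<in>\<tau>. (x \<in> M) \<noteq> (y \<in> M)"
    using gt_continuousD(2)[OF cont[OF \<alpha>(1)] M(1)] M(2) xy
    by (intro bexI[of _ "f \<alpha> -` M \<inter> X"]) auto
qed

lemma gt_T1_point_separating:
  assumes sep: "point_separating X J f"
    and cont: "\<And>\<alpha>. \<alpha> \<in> J \<Longrightarrow> gt_continuous X \<tau> (Y \<alpha>) (\<mu> \<alpha>) (f \<alpha>)"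
    and T1: "\<And>\<alpha>. \<alpha> \<in> J \<Longrightarrow> gt_T1 (Y \<alpha>) (\<mu> \<alpha>)"
  shows "gt_T1 X \<tau>"
  unfolding gt_T1_def
proof (intro ballI impI)
  fix x y assume xy: "x \<in> X" "y \<in> X" "x \<noteq> y"
  then obtain \<alpha> where \<alpha>: "\<alpha> \<in> J" "f \<alpha> x \<noteq> f \<alpha> y"
    using sep unfolding point_separating_def by blast
  then obtain M where M: "M \<in> \<mu> \<alpha>" "f \<alpha> x \<in> M" "f \<alpha> y \<notin> M"
    using T1[OF \<alpha>(1)] gt_continuousD(1)[OF cont[OF \<alpha>(1)]] xy unfolding gt_T1_def by blast
  show "\<exists>M\<in>\<tau>. x \<in> M \<and> y \<notin> M"
    using gt_continuousD(2)[OF cont[OF \<alpha>(1)] M(1)] M(2,3) xy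
    by (intro bexI[of _ "f \<alpha> -` M \<inter> X"]) auto
qed

lemma gt_T2_point_separating:
  assumes sep: "point_separating X J f"
    and cont: "\<And>\<alpha>. \<alpha> \<in> J \<Longrightarrow> gt_continuous X \<tau> (Y \<alpha>) (\<mu> \<alpha>) (f \<alpha>)"
    and T2: "\<And>\<alpha>. \<alpha> \<in> J \<Longrightarrow> gt_T2 (Y \<alpha>) (\<mu> \<alpha>)"
  shows "gt_T2 X \<tau>"
  unfolding gt_T2_def
proof (intro ballI impI)
  fix x y assume xy: "x \<in> X" "y \<in> X" "x \<noteq> y"
  then obtain \<alpha> where \<alpha>: "\<alpha> \<in> J" "f \<alpha> x \<noteq> f \<alpha> y"
    using sep unfolding point_separating_def by blast
  then obtain M N where MN: "M \<in> \<mu> \<alpha>" "N \<in> \<mu> \<alpha>" "f \<alpha> x \<in> M" "f \<alpha> y \<in> N" "M \<inter> N = {}"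
    using T2[OF \<alpha>(1)] gt_continuousD(1)[OF cont[OF \<alpha>(1)]] xy unfolding gt_T2_def by meson
  show "\<exists>M\<in>\<tau>. \<exists>N\<in>\<tau>. x \<in> M \<and> y \<in> N \<and> M \<inter> N = {}"
    using gt_continuousD(2)[OF cont[OF \<alpha>(1)] MN(1)]
      gt_continuousD(2)[OF cont[OF \<alpha>(1)] MN(2)] MN(3-5) xy
    by (intro bexI[of _ "f \<alpha> -` M \<inter> X"] bexI[of _ "f \<alpha> -` N \<inter> X"]) auto
qed

section \<open>All axioms together, subspaces and products\<close>

lemma separation_axioms_initial_gt:
  assumes gts: "\<And>\<alpha>. \<alpha> \<in> J \<Longrightarrow> gts (Y \<alpha>) (\<mu> \<alpha>)" and f: "\<And>\<alpha>. \<alpha> \<in> J \<Longrightarrow> f \<alpha> \<in> X \<rightarrow> Y \<alpha>"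
    and sep: "point_separating X J f"
  shows "\<forall>\<alpha>\<in>J. gt_T0 (Y \<alpha>) (\<mu> \<alpha>) \<Longrightarrow> gt_T0 X (initial_gt X J \<mu> f)"
    and "\<forall>\<alpha>\<in>J. gt_T1 (Y \<alpha>) (\<mu> \<alpha>) \<Longrightarrow> gt_T1 X (initial_gt X J \<mu> f)"
    and "\<forall>\<alpha>\<in>J. gt_T2 (Y \<alpha>) (\<mu> \<alpha>) \<Longrightarrow> gt_T2 X (initial_gt X J \<mu> f)"
    and "\<forall>\<alpha>\<in>J. gt_regular (Y \<alpha>) (\<mu> \<alpha>) \<Longrightarrow> gt_regular X (initial_gt X J \<mu> f)"
    and "\<forall>\<alpha>\<in>J. gt_T3 (Y \<alpha>) (\<mu> \<alpha>) \<Longrightarrow> gt_T3 X (initial_gt X J \<mu> f)"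
    and "\<forall>\<alpha>\<in>J. gt_completely_regular (Y \<alpha>) (\<mu> \<alpha>) \<Longrightarrow>
      gt_completely_regular X (initial_gt X J \<mu> f)"
    and "\<forall>\<alpha>\<in>J. gt_T3_5 (Y \<alpha>) (\<mu> \<alpha>) \<Longrightarrow> gt_T3_5 X (initial_gt X J \<mu> f)"
proof -
  have cont: "gt_continuous X (initial_gt X J \<mu> f) (Y \<alpha>) (\<mu> \<alpha>) (f \<alpha>)" if "\<alpha> \<in> J" for \<alpha>
    using gts f[OF that] that by (intro gt_continuous_initial_gt) (auto simp: gts_def)
  show "gt_T0 X (initial_gt X J \<mu> f)" if "\<forall>\<alpha>\<in>J. gt_T0 (Y \<alpha>) (\<mu> \<alpha>)"
    using gt_T0_point_separating[OF sep cont] that by blast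
  show T1: "gt_T1 X (initial_gt X J \<mu> f)" if "\<forall>\<alpha>\<in>J. gt_T1 (Y \<alpha>) (\<mu> \<alpha>)"
    using gt_T1_point_separating[OF sep cont] that by blast
  show "gt_T2 X (initial_gt X J \<mu> f)" if "\<forall>\<alpha>\<in>J. gt_T2 (Y \<alpha>) (\<mu> \<alpha>)"
    using gt_T2_point_separating[OF sep cont] that by blast
  show regular: "gt_regular X (initial_gt X J \<mu> f)" if "\<forall>\<alpha>\<in>J. gt_regular (Y \<alpha>) (\<mu> \<alpha>)"
    using gt_regular_initial_gt[of J Y \<mu> f X, OF gts f] that by blast
  show "gt_T3 X (initial_gt X J \<mu> f)" if "\<forall>\<alpha>\<in>J. gt_T3 (Y \<alpha>) (\<mu> \<alpha>)"
    using T1 regular that by (simp add: gt_T3_def)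
  show completely_regular: "gt_completely_regular X (initial_gt X J \<mu> f)"
    if "\<forall>\<alpha>\<in>J. gt_completely_regular (Y \<alpha>) (\<mu> \<alpha>)"
    using gt_completely_regular_initial_gt[of J Y \<mu> f X, OF gts f] that by blast
  show "gt_T3_5 X (initial_gt X J \<mu> f)" if "\<forall>\<alpha>\<in>J. gt_T3_5 (Y \<alpha>) (\<mu> \<alpha>)"
    using T1 completely_regular that by (simp add: gt_T3_5_def)
qed

text \<open>The index type \<open>unit\<close> turns the inclusion into a source with one member.\<close>

lemma subspace_gt_eq_initial_gt:
  "subspace_gt \<nu> Z\<^sub>0 = initial_gt Z\<^sub>0 {()} (\<lambda>_. \<nu>) (\<lambda>_ z. z)"
proof (intro equalityI subsetI)
  fix U assume "U \<in> subspace_gt \<nu> Z\<^sub>0"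
  then obtain N where "N \<in> \<nu>" "U = N \<inter> Z\<^sub>0"
    unfolding subspace_gt_def by blast
  then show "U \<in> initial_gt Z\<^sub>0 {()} (\<lambda>_. \<nu>) (\<lambda>_ z. z)"
    unfolding initial_gt_def by (auto intro!: exI[of _ "\<lambda>_. N"])
qed (auto simp: initial_gt_def subspace_gt_def)

lemma point_separating_inclusion: "point_separating Z\<^sub>0 {()} (\<lambda>_ z. z)"
  by (simp add: point_separating_def)

lemma point_separating_projections: "point_separating (Pi\<^sub>E J Y) J (\<lambda>\<alpha> y. y \<alpha>)"
  unfolding point_separating_def using PiE_ext by blast

theorem proposition4p7:
  fixes X :: "'a set" and J :: "'j set" and Y :: "'j \<Rightarrow> 'b set" and \<mu> :: "'j \<Rightarrow> 'b set set"
    and f :: "'j \<Rightarrow> 'a \<Rightarrow> 'b"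
    and Z Z\<^sub>0 :: "'c set" and \<nu> :: "'c set set"
  shows
    "((\<forall>\<alpha>\<in>J. gts (Y \<alpha>) (\<mu> \<alpha>)) \<and> (\<forall>\<alpha>\<in>J. f \<alpha> \<in> X \<rightarrow> Y \<alpha>) \<longrightarrow>
        ((\<forall>\<alpha>\<in>J. gt_regular (Y \<alpha>) (\<mu> \<alpha>)) \<longrightarrow> gt_regular X (initial_gt X J \<mu> f)) \<and>
        ((\<forall>\<alpha>\<in>J. gt_completely_regular (Y \<alpha>) (\<mu> \<alpha>)) \<longrightarrow>
           gt_completely_regular X (initial_gt X J \<mu> f)) \<and>
        (point_separating X J f \<longrightarrow>
          ((\<forall>\<alpha>\<in>J. gt_T0 (Y \<alpha>) (\<mu> \<alpha>)) \<longrightarrow> gt_T0 X (initial_gt X J \<mu> f)) \<and>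
          ((\<forall>\<alpha>\<in>J. gt_T1 (Y \<alpha>) (\<mu> \<alpha>)) \<longrightarrow> gt_T1 X (initial_gt X J \<mu> f)) \<and>
          ((\<forall>\<alpha>\<in>J. gt_T2 (Y \<alpha>) (\<mu> \<alpha>)) \<longrightarrow> gt_T2 X (initial_gt X J \<mu> f)) \<and>
          ((\<forall>\<alpha>\<in>J. gt_T3 (Y \<alpha>) (\<mu> \<alpha>)) \<longrightarrow> gt_T3 X (initial_gt X J \<mu> f)) \<and>
          ((\<forall>\<alpha>\<in>J. gt_T3_5 (Y \<alpha>) (\<mu> \<alpha>)) \<longrightarrow> gt_T3_5 X (initial_gt X J \<mu> f)))) \<and>
     (gts Z \<nu> \<and> Z\<^sub>0 \<subseteq> Z \<longrightarrow>
        (gt_T0 Z \<nu> \<longrightarrow> gt_T0 Z\<^sub>0 (subspace_gt \<nu> Z\<^sub>0)) \<and>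
        (gt_T1 Z \<nu> \<longrightarrow> gt_T1 Z\<^sub>0 (subspace_gt \<nu> Z\<^sub>0)) \<and>
        (gt_T2 Z \<nu> \<longrightarrow> gt_T2 Z\<^sub>0 (subspace_gt \<nu> Z\<^sub>0)) \<and>
        (gt_regular Z \<nu> \<longrightarrow> gt_regular Z\<^sub>0 (subspace_gt \<nu> Z\<^sub>0)) \<and>
        (gt_T3 Z \<nu> \<longrightarrow> gt_T3 Z\<^sub>0 (subspace_gt \<nu> Z\<^sub>0)) \<and>
        (gt_completely_regular Z \<nu> \<longrightarrow> gt_completely_regular Z\<^sub>0 (subspace_gt \<nu> Z\<^sub>0)) \<and>
        (gt_T3_5 Z \<nu> \<longrightarrow> gt_T3_5 Z\<^sub>0 (subspace_gt \<nu> Z\<^sub>0))) \<and>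
     ((\<forall>\<alpha>\<in>J. gts (Y \<alpha>) (\<mu> \<alpha>)) \<longrightarrow>
        ((\<forall>\<alpha>\<in>J. gt_T0 (Y \<alpha>) (\<mu> \<alpha>)) \<longrightarrow> gt_T0 (Pi\<^sub>E J Y) (product_gt J Y \<mu>)) \<and>
        ((\<forall>\<alpha>\<in>J. gt_T1 (Y \<alpha>) (\<mu> \<alpha>)) \<longrightarrow> gt_T1 (Pi\<^sub>E J Y) (product_gt J Y \<mu>)) \<and>
        ((\<forall>\<alpha>\<in>J. gt_T2 (Y \<alpha>) (\<mu> \<alpha>)) \<longrightarrow> gt_T2 (Pi\<^sub>E J Y) (product_gt J Y \<mu>)) \<and>
        ((\<forall>\<alpha>\<in>J. gt_regular (Y \<alpha>) (\<mu> \<alpha>)) \<longrightarrow> gt_regular (Pi\<^sub>E J Y) (product_gt J Y \<mu>)) \<and>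
        ((\<forall>\<alpha>\<in>J. gt_T3 (Y \<alpha>) (\<mu> \<alpha>)) \<longrightarrow> gt_T3 (Pi\<^sub>E J Y) (product_gt J Y \<mu>)) \<and>
        ((\<forall>\<alpha>\<in>J. gt_completely_regular (Y \<alpha>) (\<mu> \<alpha>)) \<longrightarrow>
           gt_completely_regular (Pi\<^sub>E J Y) (product_gt J Y \<mu>)) \<and>
        ((\<forall>\<alpha>\<in>J. gt_T3_5 (Y \<alpha>) (\<mu> \<alpha>)) \<longrightarrow> gt_T3_5 (Pi\<^sub>E J Y) (product_gt J Y \<mu>)))"
  (is "(_ \<longrightarrow> ?regular \<and> ?completely_regular \<and> ?points) \<and>
    (_ \<longrightarrow> ?subspace_axioms) \<and> (_ \<longrightarrow> ?product_axioms)" is "?initial \<and> ?subspace \<and> ?product")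
proof (intro conjI)
  show ?initial
  proof (intro impI)
    assume "(\<forall>\<alpha>\<in>J. gts (Y \<alpha>) (\<mu> \<alpha>)) \<and> (\<forall>\<alpha>\<in>J. f \<alpha> \<in> X \<rightarrow> Y \<alpha>)"
    then have gts: "\<And>\<alpha>. \<alpha> \<in> J \<Longrightarrow> gts (Y \<alpha>) (\<mu> \<alpha>)" and f: "\<And>\<alpha>. \<alpha> \<in> J \<Longrightarrow> f \<alpha> \<in> X \<rightarrow> Y \<alpha>"
      by blast+
    show "?regular \<and> ?completely_regular \<and> ?points"
    proof (intro conjI)
      show ?regular
        using gt_regular_initial_gt[of J Y \<mu> f X, OF gts f] by blast
      show ?completely_regular
        using gt_completely_regular_initial_gt[of J Y \<mu> f X, OF gts f] by blast
      show ?points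
        by (intro impI conjI separation_axioms_initial_gt[of J Y \<mu> f X, OF gts f])
    qed
  qed
  show ?subspace
  proof (intro impI)
    assume "gts Z \<nu> \<and> Z\<^sub>0 \<subseteq> Z"
    then have gts: "\<And>i. i \<in> {()} \<Longrightarrow> gts Z \<nu>" and incl: "\<And>i. i \<in> {()} \<Longrightarrow> (\<lambda>z. z) \<in> Z\<^sub>0 \<rightarrow> Z"
      by auto
    show ?subspace_axioms
      unfolding subspace_gt_eq_initial_gt
      by (intro conjI impI ballI separation_axioms_initial_gt[of "{()}" "\<lambda>_. Z" "\<lambda>_. \<nu>",
            OF gts incl point_separating_inclusion])
  qed
  show ?product
  proof (intro impI)
    assume "\<forall>\<alpha>\<in>J. gts (Y \<alpha>) (\<mu> \<alpha>)"
    then have gts: "\<And>\<alpha>. \<alpha> \<in> J \<Longrightarrow> gts (Y \<alpha>) (\<mu> \<alpha>)"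
      by blast
    have proj: "\<And>\<alpha>. \<alpha> \<in> J \<Longrightarrow> (\<lambda>y. y \<alpha>) \<in> Pi\<^sub>E J Y \<rightarrow> Y \<alpha>"
      by auto
    show ?product_axioms
      unfolding product_gt_def
      by (intro conjI impI separation_axioms_initial_gt[of J Y \<mu> "\<lambda>\<alpha> y. y \<alpha>",
            OF gts proj point_separating_projections])
  qed
qed

end
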